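(* Suppose $\mathcal{X}\subseteq\mathbb{R}^n$ is a compact convex set and $f$ is an $(M,\nu)$ generalized self-concordant function with $\nu\ge 2$, and, for the starting point $\mathbf{x}_0\in\mathcal{X}\cap\mathrm{dom}(f)$, define the compact set $$\mathcal{L}_0=\{\mathbf{x}\in\mathrm{dom}(f)\cap\mathcal{X} : f(\mathbf{x})\le f(\mathbf{x}_0)\}.$$ Then the iterates $\mathbf{x}_t$ of the Monotonic Frank-Wolfe algorithm started at $\mathbf{x}_0$ satisfy $$h(\mathbf{x}_t)\le\frac{4(T_\nu+1)}{t+1}\max\left\{h(\mathbf{x}_0),\ L_f^{\mathcal{L}_0}D^2\,\omega_\nu(1/2)\right\}$$ for $t\ge T_\nu$, where $T_\nu$ is defined as $$T_\nu=\begin{cases}\lceil 4MD\rceil-2 & \text{if }\nu=2,\\ \lceil 2MD\,(L_f^{\mathcal{L}_0})^{\nu/2-1}(\nu-2)\rceil-2 & \text{otherwise}.\end{cases}$$ Otherwise it holds that $h(\mathbf{x}_t)\le h(\mathbf{x}_0)$ for $t<T_\nu$.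
   Context: Generalized self-concordance: let $f:\mathbb{R}^n\to\mathbb{R}\cup\{+\infty\}$ be a closed convex function whose domain $\mathrm{dom}(f)=\{\mathbf{x}\in\mathbb{R}^n: f(\mathbf{x})<+\infty\}$ is open, with $f\in C^3(\mathrm{dom}(f))$. Then $f$ is $(M,\nu)$ generalized self-concordant if for any $\mathbf{x}\in\mathrm{dom}(f)$ and $\mathbf{u},\mathbf{w}\in\mathbb{R}^n$ $$|\langle D^3f(\mathbf{x})[\mathbf{w}]\mathbf{u},\mathbf{u}\rangle|\le M\,\|\mathbf{u}\|_{\nabla^2f(\mathbf{x})}^2\,\|\mathbf{w}\|_{\nabla^2f(\mathbf{x})}^{\nu-2}\,\|\mathbf{w}\|_2^{3-\nu},$$ where $D^3f(\mathbf{x})[\mathbf{w}]=\lim_{\alpha\to0}\alpha^{-1}(\nabla^2f(\mathbf{x}+\alpha\mathbf{w})-\nabla^2f(\mathbf{x}))$ and $\|\mathbf{u}\|_H^2=\langle H\mathbf{u},\mathbf{u}\rangle$. Notation: $\|\cdot\|$ is the Euclidean norm; $D=\max_{\mathbf{x},\mathbf{y}\in\mathcal{X}}\|\mathbf{x}-\mathbf{y}\|$ is the diameter of $\mathcal{X}$; $\mathbf{x}^*$ is a (potentially non-unique) minimizer of $f$ over $\mathcal{X}$; $h(\mathbf{x})=f(\mathbf{x})-f(\mathbf{x}^* )$ is the primal gap. For a compact convex set $\mathcal{C}\subseteq\mathrm{dom}(f)$, $L_f^{\mathcal{C}}=\max_{\mathbf{u}\in\mathcal{C},\,\mathbf{d}\in\mathbb{R}^n\setminus\{0\}}\|\mathbf{d}\|^2_{\nabla^2f(\mathbf{u})}/\|\mathbf{d}\|^2$.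 The function $\omega_\nu$ is $$\omega_\nu(\tau)=\begin{cases}\dfrac{e^\tau-\tau-1}{\tau^2}&\text{if }\nu=2,\\[1ex] \dfrac{-\tau-\ln(1-\tau)}{\tau^2}&\text{if }\nu=3,\\[1ex] \dfrac{(1-\tau)\ln(1-\tau)+\tau}{\tau^2}&\text{if }\nu=4,\\[1ex] \left(\dfrac{\nu-2}{4-\nu}\right)\dfrac1\tau\left[\dfrac{\nu-2}{2(3-\nu)\tau}\left((1-\tau)^{\frac{2(3-\nu)}{2-\nu}}-1\right)-1\right]&\text{otherwise.}\end{cases}$$ Monotonic Frank-Wolfe algorithm: given $\mathbf{x}_0\in\mathcal{X}\cap\mathrm{dom}(f)$, for $t=0,1,2,\dots$: let $\mathbf{v}_t\in\arg\min_{\mathbf{v}\in\mathcal{X}}\langle\nabla f(\mathbf{x}_t),\mathbf{v}\rangle$, set $\gamma_t=2/(t+2)$ and $\mathbf{x}_{t+1}=\mathbf{x}_t+\gamma_t(\mathbf{v}_t-\mathbf{x}_t)$; if this $\mathbf{x}_{t+1}\notin\mathrm{dom}(f)$ or $f(\mathbf{x}_{t+1})>f(\mathbf{x}_t)$, set instead $\mathbf{x}_{t+1}=\mathbf{x}_t$.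
   Formalization: T_ν is replaced by max{0, T_ν}: the literal formula can give −1 or −2 (e.g. f quadratic, M = 0), making the claimed bound zero or negative already at t = 0, which is false; nothing changes when T_ν ≥ 0. *)

theory Defs
  imports "HOL-Analysis.Analysis"
begin

text \<open>A function \<open>\<real>\<^sup>n \<rightarrow> \<real> \<union> {+\<infinity>}\<close> is an \<^typ>\<open>ereal\<close>-valued function that never takes
  the value \<open>-\<infinity>\<close>; differential notions refer to its real-valued restriction \<open>fin f\<close>,
  which is only meaningful on \<open>edom f\<close>.\<close>

definition edom :: "('a \<Rightarrow> ereal) \<Rightarrow> 'a set" where
  "edom f = {x. f x < \<infinity>}"

definition fin :: "('a \<Rightarrow> ereal) \<Rightarrow> 'a \<Rightarrow> real" where
  "fin f x = real_of_ereal (f x)"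

definition closed_convex_fun :: "('a::real_normed_vector \<Rightarrow> ereal) \<Rightarrow> bool" where
  "closed_convex_fun f \<longleftrightarrow>
     (\<forall>x. f x \<noteq> -\<infinity>) \<and> convex_on (edom f) (fin f) \<and> closed {(x, r :: real). f x \<le> ereal r}"

text \<open>On an open set \<open>S\<close> of a finite-dimensional space this is the class \<open>C\<^sup>k(S)\<close>: all
  iterated directional derivatives of order up to \<open>k\<close> are continuous.\<close>

fun Ck_on :: "nat \<Rightarrow> ('a::real_normed_vector \<Rightarrow> 'b::real_normed_vector) \<Rightarrow> 'a set \<Rightarrow> bool" where
  "Ck_on 0 F S \<longleftrightarrow> continuous_on S F"
| "Ck_on (Suc k) F S \<longleftrightarrow>
     (\<forall>x\<in>S. F differentiable (at x)) \<and>
     (\<forall>v. Ck_on k (\<lambda>x. frechet_derivative F (at x) v) S)"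

definition grad :: "('a::real_inner \<Rightarrow> real) \<Rightarrow> 'a \<Rightarrow> 'a" where
  "grad F x = (THE g. GDERIV F x :> g)"

definition hess :: "(real^'n \<Rightarrow> real) \<Rightarrow> real^'n \<Rightarrow> real^'n^'n" where
  "hess F x = jacobian (grad F) (at x)"

definition D3 :: "(real^'n \<Rightarrow> real) \<Rightarrow> real^'n \<Rightarrow> real^'n \<Rightarrow> real^'n^'n" where
  "D3 F x w = Lim (at (0::real)) (\<lambda>\<alpha>. (1 / \<alpha>) *\<^sub>R (hess F (x + \<alpha> *\<^sub>R w) - hess F x))"

definition mnorm :: "real^'n^'n \<Rightarrow> real^'n \<Rightarrow> real" where
  "mnorm H u = sqrt ((H *v u) \<bullet> u)"

text \<open>\<^const>\<open>powr\<close> has \<open>0 powr 0 = 0\<close>, whereas the definition below needs \<open>0\<^sup>0 = 1\<close>: for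
  \<open>\<nu> = 2\<close> the factor \<open>\<parallel>w\<parallel>\<^sub>H\<^sup>0\<close> must be absent, also in directions where the Hessian is
  degenerate. For \<open>\<nu> > 3\<close> and \<open>w = 0\<close>, the expression \<open>0\<^bsup>3-\<nu>\<^esup>\<close> evaluates to \<open>0\<close> and the
  inequality reads \<open>0 \<le> 0\<close>.\<close>

definition rpow :: "real \<Rightarrow> real \<Rightarrow> real" where
  "rpow a p = (if p = 0 then 1 else a powr p)"

definition gen_self_concordant :: "real \<Rightarrow> real \<Rightarrow> (real^'n \<Rightarrow> ereal) \<Rightarrow> bool" where
  "gen_self_concordant M \<nu> f \<longleftrightarrow>
     closed_convex_fun f \<and> open (edom f) \<and> Ck_on 3 (fin f) (edom f) \<and>
     (\<forall>x\<in>edom f. \<forall>u w.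
        \<bar>(D3 (fin f) x w *v u) \<bullet> u\<bar> \<le>
          M * (mnorm (hess (fin f) x) u)\<^sup>2
            * rpow (mnorm (hess (fin f) x) w) (\<nu> - 2) * rpow (norm w) (3 - \<nu>))"

text \<open>For nonempty compact \<open>C \<subseteq> edom f\<close> and \<open>f\<close> of class \<open>C\<^sup>2\<close> the supremum is attained.\<close>

definition Lf :: "(real^'n \<Rightarrow> ereal) \<Rightarrow> (real^'n) set \<Rightarrow> real" where
  "Lf f C = Sup {(mnorm (hess (fin f) u) d)\<^sup>2 / (norm d)\<^sup>2 | u d. u \<in> C \<and> d \<noteq> 0}"

definition omega :: "real \<Rightarrow> real \<Rightarrow> real" where
  "omega \<nu> \<tau> =
     (if \<nu> = 2 then (exp \<tau> - \<tau> - 1) / \<tau>\<^sup>2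
      else if \<nu> = 3 then (- \<tau> - ln (1 - \<tau>)) / \<tau>\<^sup>2
      else if \<nu> = 4 then ((1 - \<tau>) * ln (1 - \<tau>) + \<tau>) / \<tau>\<^sup>2
      else ((\<nu> - 2) / (4 - \<nu>)) * (1 / \<tau>) *
           ((\<nu> - 2) / (2 * (3 - \<nu>) * \<tau>) * ((1 - \<tau>) powr (2 * (3 - \<nu>) / (2 - \<nu>)) - 1) - 1))"

text \<open>The linear minimization oracle may break ties arbitrarily, so a run is a pair of
  sequences satisfying the following relation.\<close>

definition monotonic_FW ::
    "(real^'n \<Rightarrow> ereal) \<Rightarrow> (real^'n) set \<Rightarrow> real^'n \<Rightarrow> (nat \<Rightarrow> real^'n) \<Rightarrow> (nat \<Rightarrow> real^'n) \<Rightarrow> bool"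
  where
  "monotonic_FW f X x0 x v \<longleftrightarrow>
     x 0 = x0 \<and>
     (\<forall>t. is_arg_min (\<lambda>y. grad (fin f) (x t) \<bullet> y) (\<lambda>y. y \<in> X) (v t) \<and>
          x (Suc t) =
            (let y = x t + (2 / (real t + 2)) *\<^sub>R (v t - x t)
             in if y \<notin> edom f \<or> f y > f (x t) then x t else y))"

definition initial_level_set :: "(real^'n \<Rightarrow> ereal) \<Rightarrow> (real^'n) set \<Rightarrow> real^'n \<Rightarrow> (real^'n) set" where
  "initial_level_set f X x0 = {x \<in> edom f \<inter> X. f x \<le> f x0}"

definition primal_gap :: "('a \<Rightarrow> ereal) \<Rightarrow> 'a \<Rightarrow> 'a \<Rightarrow> real" where
  "primal_gap f xstar x = fin f x - fin f xstar"

text \<open>\<open>T\<^sub>\<nu>\<close> is an iteration index, so the formula is truncated at \<open>0\<close>. Without truncation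
  it could be \<open>-1\<close> or \<open>-2\<close> (e.g. for quadratics, where \<open>M = 0\<close>), and the bound
  \<open>4(T\<^sub>\<nu> + 1)/(t + 1) \<dots>\<close> would then not be positive, already at \<open>t = 0\<close>.\<close>

definition T_idx :: "real \<Rightarrow> real \<Rightarrow> real \<Rightarrow> real \<Rightarrow> nat" where
  "T_idx M \<nu> D L =
     nat (if \<nu> = 2 then \<lceil>4 * M * D\<rceil> - 2
          else \<lceil>2 * M * D * L powr (\<nu> / 2 - 1) * (\<nu> - 2)\<rceil> - 2)"

end

theory Submission
  imports Defs
begin

text \<open>Along a segment from \<open>x\<close> in direction \<open>d\<close>, generalized self-concordance says that
  \<open>\<psi> t = \<parallel>d\<parallel>\<^sup>2\<close> (in the norm of the Hessian at \<open>x + t d\<close>) satisfies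
  \<open>\<psi>' \<le> K \<psi> powr (\<nu> / 2)\<close>. As soon as \<open>t \<ge> T\<^sub>\<nu>\<close>, the Frank-Wolfe step is so short that the
  explicit majorant of this differential inequality exists up to time \<open>1\<close>, which keeps the step inside
  the domain; integrating it twice yields
  \<open>f (x + d) \<le> f x + \<langle>\<nabla>f x, d\<rangle> + \<psi> 0 * \<omega>\<^sub>\<nu> (1/2)\<close>. Together with the Frank-Wolfe gap bound
  this gives \<open>h (x (t+1)) \<le> (1 - \<gamma>) h (x t) + \<gamma>\<^sup>2 L D\<^sup>2 \<omega>\<^sub>\<nu> (1/2)\<close>, hence the rate \<open>1/t\<close>.\<close>

section \<open>The scalar differential inequality\<close>

text \<open>The solution of \<open>\<psi>' = K \<psi> powr (\<nu> / 2)\<close>, \<open>\<psi> 0 = 1\<close>, in the borderline case where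
  \<open>K = 1/2\<close> (for \<open>\<nu> = 2\<close>) or \<open>(\<nu> / 2 - 1) K = 1/2\<close> (for \<open>\<nu> > 2\<close>). Its second antiderivative takes the
  value \<open>\<omega>\<^sub>\<nu> (1/2)\<close> at \<open>1\<close>.\<close>

definition gsc_majorant :: "real \<Rightarrow> real \<Rightarrow> real" where
  "gsc_majorant \<nu> t = (if \<nu> = 2 then exp (t / 2) else (1 - t / 2) powr (- 2 / (\<nu> - 2)))"

lemma gsc_majorant_nonneg: "gsc_majorant \<nu> t \<ge> 0"
  by (simp add: gsc_majorant_def)

text \<open>Two integrations, each done by monotonicity: \<open>B * G1 - \<phi>1\<close> is
  nondecreasing, which bounds \<open>\<phi>1\<close>, and this in turn makes
  \<open>\<phi>1 0 * s + B * G s - \<phi> s\<close> nondecreasing.\<close>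

lemma second_order_comparison:
  fixes \<phi> \<phi>1 \<phi>2 G G1 g :: "real \<Rightarrow> real"
  assumes "0 \<le> t"
    and \<phi>: "\<And>s. s \<in> {0..t} \<Longrightarrow> (\<phi> has_real_derivative \<phi>1 s) (at s)"
    and \<phi>1: "\<And>s. s \<in> {0..t} \<Longrightarrow> (\<phi>1 has_real_derivative \<phi>2 s) (at s)"
    and G: "\<And>s. s \<in> {0..t} \<Longrightarrow> (G has_real_derivative G1 s) (at s)"
    and G1: "\<And>s. s \<in> {0..t} \<Longrightarrow> (G1 has_real_derivative g s) (at s)"
    and G0: "G 0 = 0" "G1 0 = 0"
    and le: "\<And>s. s \<in> {0..t} \<Longrightarrow> \<phi>2 s \<le> B * g s"
  shows "\<phi> t \<le> \<phi> 0 + \<phi>1 0 * t + B * G t"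
proof -
  have first: "\<phi>1 s \<le> \<phi>1 0 + B * G1 s" if s: "s \<in> {0..t}" for s
  proof -
    have "B * G1 0 - \<phi>1 0 \<le> B * G1 s - \<phi>1 s"
    proof (rule DERIV_nonneg_imp_nondecreasing[where f = "\<lambda>s. B * G1 s - \<phi>1 s"])
      fix r assume "0 \<le> r" "r \<le> s"
      then have r: "r \<in> {0..t}" using s by auto
      have "((\<lambda>s. B * G1 s - \<phi>1 s) has_real_derivative (B * g r - \<phi>2 r)) (at r)"
        by (auto intro!: derivative_eq_intros G1[OF r] \<phi>1[OF r])
      then show "\<exists>y. ((\<lambda>s. B * G1 s - \<phi>1 s) has_real_derivative y) (at r) \<and> 0 \<le> y"
        using le[OF r] by auto
    qed (use s in auto)
    then show ?thesis using G0 by simp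
  qed
  have "\<phi>1 0 * 0 + B * G 0 - \<phi> 0 \<le> \<phi>1 0 * t + B * G t - \<phi> t"
  proof (rule DERIV_nonneg_imp_nondecreasing[where f = "\<lambda>s. \<phi>1 0 * s + B * G s - \<phi> s"])
    fix r assume "0 \<le> r" "r \<le> t"
    then have r: "r \<in> {0..t}" by auto
    have "((\<lambda>s. \<phi>1 0 * s + B * G s - \<phi> s) has_real_derivative (\<phi>1 0 + B * G1 r - \<phi>1 r)) (at r)"
      by (auto intro!: derivative_eq_intros G[OF r] \<phi>[OF r])
    then show "\<exists>y. ((\<lambda>s. \<phi>1 0 * s + B * G s - \<phi> s) has_real_derivative y) (at r) \<and> 0 \<le> y"
      using first[OF r] by auto
  qed (use assms in auto)
  then show ?thesis using G0 by simp
qed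

text \<open>Explains where \<open>omega\<close> comes from: its value at \<open>1/2\<close> is the
  majorant integrated twice from 0 to 1. The branches of \<open>omega\<close> mirror the power rule,
  which produces a logarithm at the first integration for \<open>\<nu> = 4\<close> and at the second
  for \<open>\<nu> = 3\<close>.\<close>

lemma omega_half_antiderivative:
  assumes "\<nu> \<ge> 2"
  obtains G G1 :: "real \<Rightarrow> real"
  where "G 0 = 0" "G1 0 = 0" "G 1 = omega \<nu> (1/2)"
    "\<And>t. t \<in> {0..1} \<Longrightarrow> (G has_real_derivative G1 t) (at t)"
    "\<And>t. t \<in> {0..1} \<Longrightarrow> (G1 has_real_derivative gsc_majorant \<nu> t) (at t)"
proof -
  consider "\<nu> = 2" | "\<nu> = 3" | "\<nu> = 4" | "\<nu> \<noteq> 2" "\<nu> \<noteq> 3" "\<nu> \<noteq> 4" by blast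
  then show thesis
  proof cases
    case 1
    show ?thesis
    proof (rule that[of "\<lambda>t. 4 * (exp (t / 2) - t / 2 - 1)" "\<lambda>t. 2 * (exp (t / 2) - 1)"])
      fix t :: real
      show "((\<lambda>t. 4 * (exp (t / 2) - t / 2 - 1)) has_real_derivative 2 * (exp (t / 2) - 1)) (at t)"
        by (auto intro!: derivative_eq_intros)
      show "((\<lambda>t. 2 * (exp (t / 2) - 1)) has_real_derivative gsc_majorant \<nu> t) (at t)"
        using 1 by (auto simp: gsc_majorant_def intro!: derivative_eq_intros)
    qed (use 1 in \<open>simp_all add: omega_def power2_eq_square\<close>)
  next
    case 2
    show ?thesis
    proof (rule that[of "\<lambda>t. - 4 * ln (1 - t / 2) - 2 * t" "\<lambda>t. 2 / (1 - t / 2) - 2"])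
      fix t :: real assume t: "t \<in> {0..1}"
      show "((\<lambda>t. - 4 * ln (1 - t / 2) - 2 * t) has_real_derivative 2 / (1 - t / 2) - 2) (at t)"
        using t by (auto intro!: derivative_eq_intros simp: field_simps)
      have "((\<lambda>t. 2 / (1 - t / 2) - 2) has_real_derivative 1 / (1 - t / 2)\<^sup>2) (at t)"
        using t by (auto intro!: derivative_eq_intros simp: power2_eq_square)
      also have "1 / (1 - t / 2)\<^sup>2 = gsc_majorant \<nu> t"
        using t 2 by (simp add: gsc_majorant_def powr_minus inverse_eq_divide)
      finally show "((\<lambda>t. 2 / (1 - t / 2) - 2) has_real_derivative gsc_majorant \<nu> t) (at t)" .
    qed (use 2 in \<open>simp_all add: omega_def power2_eq_square field_simps\<close>)
  next
    case 3
    show ?thesis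
    proof (rule that[of "\<lambda>t. 4 * ((1 - t / 2) * ln (1 - t / 2) + t / 2)" "\<lambda>t. - 2 * ln (1 - t / 2)"])
      fix t :: real assume t: "t \<in> {0..1}"
      then have pos: "1 - t / 2 > 0" by auto
      have "((\<lambda>t. 4 * ((1 - t / 2) * ln (1 - t / 2) + t / 2)) has_real_derivative
          4 * (- 1 / 2 * ln (1 - t / 2) + (1 - t / 2) * (- 1 / 2 / (1 - t / 2)) + 1 / 2)) (at t)"
        using pos by (auto intro!: derivative_eq_intros)
      also have "4 * (- 1 / 2 * ln (1 - t / 2) + (1 - t / 2) * (- 1 / 2 / (1 - t / 2)) + 1 / 2) = - 2 * ln (1 - t / 2)"
        using pos by (simp add: field_simps)
      finally show "((\<lambda>t. 4 * ((1 - t / 2) * ln (1 - t / 2) + t / 2)) has_real_derivative - 2 * ln (1 - t / 2)) (at t)" .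
      show "((\<lambda>t. - 2 * ln (1 - t / 2)) has_real_derivative gsc_majorant \<nu> t) (at t)"
        using pos 3
        by (auto intro!: derivative_eq_intros simp: gsc_majorant_def powr_minus inverse_eq_divide field_simps)
    qed (use 3 in \<open>simp_all add: omega_def power2_eq_square field_simps\<close>)
  next
    case 4
    \<comment> \<open>The majorant is \<open>(1 - t / 2) powr (- a)\<close>, so the antiderivatives
      have exponents \<open>1 - a\<close> and \<open>2 - a\<close>. The logarithmic cases
      \<open>\<nu> = 4\<close> and \<open>\<nu> = 3\<close> are exactly \<open>a = 1\<close> and
      \<open>a = 2\<close>.\<close>
    define a where "a = 2 / (\<nu> - 2)"
    have a: "a \<noteq> 1" "a \<noteq> 2" using 4 by (simp_all add: a_def divide_eq_eq)
    define G where "G = (\<lambda>t. 2 / (a - 1) * (2 / (a - 2) * ((1 - t / 2) powr (2 - a) - 1) - t))"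
    define G1 where "G1 = (\<lambda>t. 2 / (a - 1) * ((1 - t / 2) powr (1 - a) - 1))"
    have aff: "((\<lambda>t::real. 1 - t / 2) has_real_derivative - 1 / 2) (at t)" for t
      by (auto intro!: derivative_eq_intros)
    show ?thesis
    proof (rule that[of G G1])
      fix t :: real assume t: "t \<in> {0..1}"
      then have pos: "1 - t / 2 > 0" by auto
      have "((\<lambda>t. (1 - t / 2) powr (2 - a)) has_real_derivative
              (2 - a) * (1 - t / 2) powr (2 - a - 1) * (- 1 / 2)) (at t)"
        by (rule DERIV_chain2[OF has_real_derivative_powr[OF pos] aff])
      then have "(G has_real_derivative
          2 / (a - 1) * (2 / (a - 2) * ((2 - a) * (1 - t / 2) powr (2 - a - 1) * (- 1 / 2) - 0) - 1)) (at t)"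
        unfolding G_def by (intro DERIV_cmult DERIV_diff DERIV_const DERIV_ident)
      moreover have "2 / (a - 2) * ((2 - a) * (1 - t / 2) powr (2 - a - 1) * (- 1 / 2)) = (1 - t / 2) powr (1 - a)"
        using a by (simp add: field_simps)
      ultimately show "(G has_real_derivative G1 t) (at t)" by (simp only: G1_def diff_0_right)
      have "((\<lambda>t. (1 - t / 2) powr (1 - a)) has_real_derivative
              (1 - a) * (1 - t / 2) powr (1 - a - 1) * (- 1 / 2)) (at t)"
        by (rule DERIV_chain2[OF has_real_derivative_powr[OF pos] aff])
      then have "(G1 has_real_derivative
          2 / (a - 1) * ((1 - a) * (1 - t / 2) powr (1 - a - 1) * (- 1 / 2) - 0)) (at t)"
        unfolding G1_def by (intro DERIV_cmult DERIV_diff DERIV_const)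
      moreover have "2 / (a - 1) * ((1 - a) * (1 - t / 2) powr (1 - a - 1) * (- 1 / 2)) = (1 - t / 2) powr (- a)"
        using a by (simp add: field_simps)
      moreover have "gsc_majorant \<nu> t = (1 - t / 2) powr (- a)" using 4 by (simp add: gsc_majorant_def a_def)
      ultimately show "(G1 has_real_derivative gsc_majorant \<nu> t) (at t)" by (simp only: diff_0_right)
    next
      have e: "2 - a = 2 * (3 - \<nu>) / (2 - \<nu>)" "2 / (a - 1) = 2 * ((\<nu> - 2) / (4 - \<nu>))"
        "2 / (a - 2) = (\<nu> - 2) / (3 - \<nu>)"
        using 4 by (simp_all add: a_def divide_simps) (simp_all add: algebra_simps)
      have e': "2 * (3 - \<nu>) * (1 / 2) = 3 - \<nu>" by simp
      have "omega \<nu> (1/2) = (\<nu> - 2) / (4 - \<nu>) * 2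
          * ((\<nu> - 2) / (3 - \<nu>) * ((1 / 2) powr (2 * (3 - \<nu>) / (2 - \<nu>)) - 1) - 1)"
        using 4 unfolding omega_def e' by simp
      then show "G 1 = omega \<nu> (1/2)"
        using 4 unfolding G_def e by (simp add: mult.commute)
    qed (simp_all add: G_def G1_def)
  qed
qed

text \<open>The second antiderivative has zero initial data and a nonnegative second derivative, so
  it dominates the zero function at 1.\<close>

lemma omega_half_nonneg:
  assumes "\<nu> \<ge> 2"
  shows "omega \<nu> (1/2) \<ge> 0"
proof -
  obtain G G1 where "G 0 = 0" "G1 0 = 0" "G 1 = omega \<nu> (1/2)"
    "\<And>t. t \<in> {0..1} \<Longrightarrow> (G has_real_derivative G1 t) (at t)"
    "\<And>t. t \<in> {0..1} \<Longrightarrow> (G1 has_real_derivative gsc_majorant \<nu> t) (at t)"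
    using omega_half_antiderivative[OF assms] by metis
  then show ?thesis
    using second_order_comparison[of 1 "\<lambda>_. 0" "\<lambda>_. 0" "\<lambda>_. 0" G G1 "gsc_majorant \<nu>" 1]
    by (simp add: gsc_majorant_nonneg)
qed

text \<open>The Bernoulli substitution \<open>p powr (- q)\<close> linearizes the inequality:
  \<open>p s powr (- q) + q * K * s\<close> is nondecreasing. Raising to the negative power
  \<open>- 1 / q\<close> reverses the resulting estimate; the bound below 1 on
  \<open>q * K * p 0 powr q\<close> rules out blow-up up to time 1.\<close>

lemma Bernoulli_differential_inequality:
  fixes p p' :: "real \<Rightarrow> real"
  assumes q: "q > 0" and t: "0 \<le> t" "t \<le> 1"
    and p: "\<And>s. s \<in> {0..t} \<Longrightarrow> (p has_real_derivative p' s) (at s)"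
    and pos: "\<And>s. s \<in> {0..t} \<Longrightarrow> p s > 0"
    and p': "\<And>s. s \<in> {0..t} \<Longrightarrow> p' s \<le> K * p s powr (q + 1)"
    and \<tau>: "q * K * p 0 powr q < 1" and K: "K \<ge> 0"
  shows "p t \<le> p 0 * (1 - q * K * p 0 powr q * t) powr (- 1 / q)"
proof -
  have "p 0 powr (- q) + q * K * 0 \<le> p t powr (- q) + q * K * t"
  proof (rule DERIV_nonneg_imp_nondecreasing[where f = "\<lambda>s. p s powr (- q) + q * K * s"])
    fix r assume "0 \<le> r" "r \<le> t"
    then have r: "r \<in> {0..t}" by auto
    have "((\<lambda>s. p s powr (- q) + q * K * s) has_real_derivative
        (- q) * p r powr (- q - 1) * p' r + q * K) (at r)"
      using pos[OF r] by (auto intro!: derivative_eq_intros p[OF r])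
    moreover have "p r powr (- q - 1) * p' r \<le> p r powr (- q - 1) * (K * p r powr (q + 1))"
      by (intro mult_left_mono p' r) auto
    then have "p r powr (- q - 1) * p' r \<le> K"
      using pos[OF r] by (simp add: mult.left_commute flip: powr_add)
    then have "q * (p r powr (- q - 1) * p' r) \<le> q * K" using q by simp
    then have "0 \<le> (- q) * p r powr (- q - 1) * p' r + q * K" by (simp add: mult.assoc)
    ultimately show "\<exists>y. ((\<lambda>s. p s powr (- q) + q * K * s) has_real_derivative y) (at r) \<and> 0 \<le> y"
      by blast
  qed (rule t)
  moreover have p0: "p 0 > 0" and pt: "p t > 0" using pos t by auto
  moreover have "p 0 powr (- q) * (1 - q * K * p 0 powr q * t) = p 0 powr (- q) - q * K * t"
    using p0 by (simp add: algebra_simps flip: powr_add)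
  ultimately have *: "p 0 powr (- q) * (1 - q * K * p 0 powr q * t) \<le> p t powr (- q)" by simp
  have nn: "0 \<le> q * K * p 0 powr q" using q K by simp
  have "q * K * p 0 powr q * t \<le> q * K * p 0 powr q * 1" using nn t by (intro mult_left_mono) auto
  then have u: "1 - q * K * p 0 powr q * t > 0" using \<tau> by linarith
  have "(p t powr (- q)) powr (- 1 / q) \<le> (p 0 powr (- q) * (1 - q * K * p 0 powr q * t)) powr (- 1 / q)"
    by (rule powr_mono2') (use * q u p0 in auto)
  then show ?thesis using q p0 pt u by (simp add: powr_mult powr_powr)
qed

text \<open>The Hessian may be degenerate, so \<open>\<phi>2\<close> may vanish; for \<open>\<nu> > 2\<close> the inequality is therefore
  integrated for \<open>\<phi>2 + \<epsilon>\<close>, and then \<open>\<epsilon>\<close> tends to \<open>0\<close>.\<close>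

lemma gsc_second_derivative_bound:
  fixes \<phi>2 \<phi>3 :: "real \<Rightarrow> real"
  assumes \<nu>: "\<nu> \<ge> 2" and t: "0 \<le> t" "t \<le> 1"
    and d: "\<And>s. s \<in> {0..t} \<Longrightarrow> (\<phi>2 has_real_derivative \<phi>3 s) (at s)"
    and nn: "\<And>s. s \<in> {0..t} \<Longrightarrow> \<phi>2 s \<ge> 0"
    and le: "\<And>s. s \<in> {0..t} \<Longrightarrow> \<phi>3 s \<le> K * \<phi>2 s powr (\<nu> / 2)"
    and K: "K \<ge> 0"
    and small: "if \<nu> = 2 then K \<le> 1 / 2 else (\<nu> / 2 - 1) * K * \<phi>2 0 powr (\<nu> / 2 - 1) \<le> 1 / 2"
  shows "\<phi>2 t \<le> \<phi>2 0 * gsc_majorant \<nu> t"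
proof (cases "\<nu> = 2")
  case True
  \<comment> \<open>For \<open>\<nu> = 2\<close> the inequality is linear, and
    \<open>exp (- s / 2)\<close> is its integrating factor for the extreme value
    \<open>K = 1/2\<close>.\<close>
  have "\<phi>2 t * exp (- t / 2) \<le> \<phi>2 0 * exp (- 0 / 2)"
  proof (rule DERIV_nonpos_imp_nonincreasing[where f = "\<lambda>s. \<phi>2 s * exp (- s / 2)"])
    fix r assume "0 \<le> r" "r \<le> t"
    then have r: "r \<in> {0..t}" by auto
    have "((\<lambda>s. \<phi>2 s * exp (- s / 2)) has_real_derivative (\<phi>3 r - \<phi>2 r / 2) * exp (- r / 2)) (at r)"
      by (auto intro!: derivative_eq_intros d[OF r] simp: algebra_simps)
    moreover have "\<phi>3 r \<le> \<phi>2 r / 2"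
    proof -
      have "\<phi>3 r \<le> K * \<phi>2 r" using le[OF r] nn[OF r] True by simp
      also have "\<dots> \<le> 1 / 2 * \<phi>2 r" using small True nn[OF r] by (intro mult_right_mono) auto
      finally show ?thesis by simp
    qed
    then have "(\<phi>3 r - \<phi>2 r / 2) * exp (- r / 2) \<le> 0"
      by (simp add: mult_nonpos_nonneg)
    ultimately show "\<exists>y. ((\<lambda>s. \<phi>2 s * exp (- s / 2)) has_real_derivative y) (at r) \<and> y \<le> 0" by blast
  qed (rule t)
  then show ?thesis using True by (simp add: gsc_majorant_def exp_minus field_simps)
next
  case False
  define q where "q = \<nu> / 2 - 1"
  have q: "q > 0" using False \<nu> by (simp add: q_def)
  \<comment> \<open>The blow-up coefficient of the perturbed inequality. It is at most 1/2 at
    \<epsilon> = 0, hence by continuity below 1 for small positive \<epsilon>.\<close>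
  define \<tau> where "\<tau> = (\<lambda>\<epsilon>. q * K * (\<phi>2 0 + \<epsilon>) powr q)"
  have nn0: "\<phi>2 0 \<ge> 0" using nn t by auto
  have \<tau>0: "\<tau> 0 \<le> 1 / 2" using small False by (simp add: \<tau>_def q_def)
  have lim: "(\<tau> \<longlongrightarrow> \<tau> 0) (at_right 0)"
    unfolding \<tau>_def using q nn0
    by (intro tendsto_intros disjI2 conjI) (auto simp: eventually_at_right_field intro!: exI[of _ 1])
  have ev: "eventually (\<lambda>\<epsilon>. \<tau> \<epsilon> < 1) (at_right 0)"
    by (rule order_tendstoD(2)[OF lim]) (use \<tau>0 in simp)
  have "eventually (\<lambda>\<epsilon>. \<phi>2 t + \<epsilon> \<le> (\<phi>2 0 + \<epsilon>) * (1 - \<tau> \<epsilon> * t) powr (- 1 / q)) (at_right 0)"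
    using ev eventually_at_right_less
  proof eventually_elim
    case (elim \<epsilon>)
    have "\<phi>2 t + \<epsilon> \<le> (\<phi>2 0 + \<epsilon>) * (1 - q * K * (\<phi>2 0 + \<epsilon>) powr q * t) powr (- 1 / q)"
    proof (rule Bernoulli_differential_inequality[OF q t])
      fix s assume s: "s \<in> {0..t}"
      show "((\<lambda>s. \<phi>2 s + \<epsilon>) has_real_derivative \<phi>3 s) (at s)"
        by (auto intro!: derivative_eq_intros d[OF s])
      show "\<phi>2 s + \<epsilon> > 0" using nn[OF s] elim by linarith
      have "\<phi>3 s \<le> K * \<phi>2 s powr (q + 1)" using le[OF s] by (simp add: q_def)
      also have "\<dots> \<le> K * (\<phi>2 s + \<epsilon>) powr (q + 1)"
        using nn[OF s] elim q K by (intro mult_left_mono powr_mono2) auto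
      finally show "\<phi>3 s \<le> K * (\<phi>2 s + \<epsilon>) powr (q + 1)" .
    qed (use elim K in \<open>auto simp: \<tau>_def\<close>)
    then show ?case by (simp add: \<tau>_def)
  qed
  moreover have tt: "\<tau> 0 * t \<le> 1 / 2 * t"
    using \<tau>0 t by (intro mult_right_mono) auto
  then have pos: "1 - \<tau> 0 * t > 0" using t by linarith
  have "((\<lambda>\<epsilon>. (\<phi>2 0 + \<epsilon>) * (1 - \<tau> \<epsilon> * t) powr (- 1 / q)) \<longlongrightarrow> (\<phi>2 0 + 0) * (1 - \<tau> 0 * t) powr (- 1 / q)) (at_right 0)"
    by (intro tendsto_intros lim disjI1) (use pos q in auto)
  moreover have "((\<lambda>\<epsilon>. \<phi>2 t + \<epsilon>) \<longlongrightarrow> \<phi>2 t + 0) (at_right 0)"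
    by (intro tendsto_intros)
  ultimately have "\<phi>2 t + 0 \<le> (\<phi>2 0 + 0) * (1 - \<tau> 0 * t) powr (- 1 / q)"
    by (intro tendsto_le) auto
  \<comment> \<open>The exponent is negative, so replacing \<open>\<tau> 0\<close> by its upper
    bound 1/2 only enlarges the right-hand side and leaves a majorant free of
    \<open>K\<close>.\<close>
  also have "\<dots> \<le> \<phi>2 0 * (1 - t / 2) powr (- 1 / q)"
    using tt t q nn0 by (auto intro!: mult_left_mono powr_mono2')
  also have "- 1 / q = - 2 / (\<nu> - 2)" using False by (simp add: q_def field_simps)
  finally show ?thesis using False by (simp add: gsc_majorant_def)
qed

section \<open>Gradient, Hessian and third derivative along lines\<close>

text \<open>Since \<open>grad\<close> is a definite description, existence and uniqueness must be
  shown first: the Riesz representative of the derivative is its adjoint applied to 1.\<close>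

lemma grad_inner:
  fixes F :: "'a::euclidean_space \<Rightarrow> real"
  assumes "F differentiable (at x)"
  shows "grad F x \<bullet> v = frechet_derivative F (at x) v"
proof -
  let ?D = "frechet_derivative F (at x)"
  have D: "(F has_derivative ?D) (at x)" using assms by (simp add: frechet_derivative_works)
  have rep: "?D = (\<lambda>h. h \<bullet> adjoint ?D 1)"
    using adjoint_works[OF has_derivative_linear[OF D], of _ 1] by auto
  have "GDERIV F x :> adjoint ?D 1" using D rep by (simp add: gderiv_def)
  moreover have "g = adjoint ?D 1" if "GDERIV F x :> g" for g
  proof -
    have "(\<lambda>h. h \<bullet> g) = ?D" using has_derivative_unique[OF _ D] that by (simp add: gderiv_def)
    then have "h \<bullet> g = h \<bullet> adjoint ?D 1" for h using rep by metis
    then show ?thesis by (metis vector_eq_ldot)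
  qed
  ultimately have "grad F x = adjoint ?D 1" unfolding grad_def by (intro the_equality)
  then show ?thesis by (metis rep inner_commute)
qed

text \<open>The Jacobian is meaningful only once \<open>grad F\<close> is differentiable. This is
  checked componentwise, each component of the gradient being a directional derivative of
  \<open>F\<close> on the open set \<open>S\<close>.\<close>

lemma hess_has_derivative:
  fixes F :: "real^'n \<Rightarrow> real"
  assumes S: "open S" "x \<in> S" and F: "\<And>y. y \<in> S \<Longrightarrow> F differentiable (at y)"
    and F2: "\<And>v. (\<lambda>y. frechet_derivative F (at y) v) differentiable (at x)"
  shows "(grad F has_derivative (\<lambda>h. hess F x *v h)) (at x)"
proof -
  have "(\<lambda>y. grad F y \<bullet> v) differentiable (at x)" for v
  proof -
    obtain D where "((\<lambda>y. frechet_derivative F (at y) v) has_derivative D) (at x)"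
      using F2[of v] by (auto simp: differentiable_def)
    then have "((\<lambda>y. grad F y \<bullet> v) has_derivative D) (at x)"
      by (rule has_derivative_transform_within_open[OF _ S]) (simp add: grad_inner F)
    then show ?thesis by (auto simp: differentiable_def)
  qed
  then have "grad F differentiable (at x)"
    by (simp add: differentiable_componentwise_within[of "grad F" x UNIV])
  then show ?thesis by (simp add: hess_def jacobian_works)
qed

text \<open>Translates between \<open>hess\<close>, in which self-concordance is phrased, and the
  iterated directional derivatives that \<open>Ck_on\<close> controls.\<close>

lemma hess_inner:
  fixes F :: "real^'n \<Rightarrow> real"
  assumes S: "open S" "x \<in> S" and F: "\<And>y. y \<in> S \<Longrightarrow> F differentiable (at y)"
    and F2: "\<And>v. (\<lambda>y. frechet_derivative F (at y) v) differentiable (at x)"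
  shows "(hess F x *v u) \<bullet> w = frechet_derivative (\<lambda>y. frechet_derivative F (at y) w) (at x) u"
proof -
  have "((\<lambda>y. grad F y \<bullet> w) has_derivative (\<lambda>h. (hess F x *v h) \<bullet> w)) (at x)"
    by (intro has_derivative_inner_left hess_has_derivative[OF S F F2])
  then have "((\<lambda>y. frechet_derivative F (at y) w) has_derivative (\<lambda>h. (hess F x *v h) \<bullet> w)) (at x)"
    by (rule has_derivative_transform_within_open[OF _ S]) (simp add: grad_inner F)
  from frechet_derivative_at[OF this] show ?thesis by metis
qed

lemma bounded_linear_quadratic_form: "bounded_linear (\<lambda>A :: real^'n^'n. (A *v u) \<bullet> u)"
proof -
  have "linear (\<lambda>A :: real^'n^'n. (A *v u) \<bullet> u)"
    by (rule linearI) (simp_all add: matrix_vector_mult_add_rdistrib inner_add_left flip: scaleR_matrix_vector_assoc)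
  then show ?thesis by (simp only: linear_conv_bounded_linear)
qed

text \<open>Entry by entry: every entry of the Hessian is a second directional derivative along
  coordinate vectors, and these are differentiable by assumption.\<close>

lemma hess_differentiable:
  fixes F :: "real^'n \<Rightarrow> real"
  assumes S: "open S" "x \<in> S" and F: "\<And>y. y \<in> S \<Longrightarrow> F differentiable (at y)"
    and F2: "\<And>y v. y \<in> S \<Longrightarrow> (\<lambda>y. frechet_derivative F (at y) v) differentiable (at y)"
    and F3: "\<And>u v. (\<lambda>y. frechet_derivative (\<lambda>y. frechet_derivative F (at y) v) (at y) u)
               differentiable (at x)"
  shows "hess F differentiable (at x)"
proof -
  have "(\<lambda>y. hess F y \<bullet> axis i (axis j 1)) differentiable (at x)" for i j :: 'n
  proof -
    obtain D where "((\<lambda>y. frechet_derivative (\<lambda>y. frechet_derivative F (at y) (axis i 1)) (at y) (axis j 1))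
        has_derivative D) (at x)"
      using F3[of "axis i 1" "axis j 1"] by (auto simp: differentiable_def)
    then have "((\<lambda>y. hess F y \<bullet> axis i (axis j 1)) has_derivative D) (at x)"
    proof (rule has_derivative_transform_within_open[OF _ S])
      fix y assume y: "y \<in> S"
      show "frechet_derivative (\<lambda>y. frechet_derivative F (at y) (axis i 1)) (at y) (axis j 1)
          = hess F y \<bullet> axis i (axis j 1)"
        using hess_inner[OF S(1) y F F2[OF y], of "axis j 1" "axis i 1"]
        by (simp add: inner_axis matrix_vector_mult_basis column_def)
    qed
    then show ?thesis by (auto simp: differentiable_def)
  qed
  then have "\<forall>b\<in>Basis. (\<lambda>y. hess F y \<bullet> b) differentiable (at x)"
    by (auto simp: Basis_vec_def)
  then show ?thesis
    by (simp add: differentiable_componentwise_within[of "hess F" x UNIV])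
qed

lemma tendsto_directional_difference_quotient:
  fixes H :: "'a::real_normed_vector \<Rightarrow> 'b::real_normed_vector"
  assumes "(H has_derivative D) (at x)"
  shows "((\<lambda>\<alpha>::real. (1 / \<alpha>) *\<^sub>R (H (x + \<alpha> *\<^sub>R w) - H x)) \<longlongrightarrow> D w) (at 0)"
proof -
  have "((\<lambda>\<alpha>::real. x + \<alpha> *\<^sub>R w) has_derivative (\<lambda>\<alpha>. \<alpha> *\<^sub>R w)) (at 0)"
    by (auto intro!: derivative_eq_intros)
  then have "((\<lambda>\<alpha>. H (x + \<alpha> *\<^sub>R w)) has_derivative (\<lambda>\<alpha>. D (\<alpha> *\<^sub>R w))) (at 0)"
    by (rule has_derivative_compose) (use assms in simp)
  then have "(\<lambda>h. norm (H (x + h *\<^sub>R w) - H x - D (h *\<^sub>R w)) / norm h) \<midarrow>0\<rightarrow> 0"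
    by (simp add: has_derivative_at)
  then have "(\<lambda>h. norm ((1 / h) *\<^sub>R (H (x + h *\<^sub>R w) - H x) - D w)) \<midarrow>0\<rightarrow> 0"
  proof (rule tendsto_cong[THEN iffD1, rotated])
    show "\<forall>\<^sub>F h in at 0. norm (H (x + h *\<^sub>R w) - H x - D (h *\<^sub>R w)) / norm h
        = norm ((1 / h) *\<^sub>R (H (x + h *\<^sub>R w) - H x) - D w)"
      unfolding eventually_at
    proof (intro exI[of _ 1] conjI ballI impI)
      fix h :: real assume "h \<noteq> 0 \<and> dist h 0 < 1"
      then have "(1 / h) *\<^sub>R (H (x + h *\<^sub>R w) - H x) - D w
          = (1 / h) *\<^sub>R (H (x + h *\<^sub>R w) - H x - D (h *\<^sub>R w))"
        by (simp add: linear_scale[OF has_derivative_linear[OF assms]] scaleR_right_diff_distrib)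
      then show "norm (H (x + h *\<^sub>R w) - H x - D (h *\<^sub>R w)) / norm h
        = norm ((1 / h) *\<^sub>R (H (x + h *\<^sub>R w) - H x) - D w)" by simp
    qed simp
  qed
  then show ?thesis by (metis tendsto_norm_zero_cancel LIM_zero_cancel)
qed

text \<open>The limit defining \<open>D3\<close> is the derivative of \<open>hess\<close> in
  direction \<open>w\<close>. Composing with a linear functional of the matrix then differentiates
  the quadratic form.\<close>

lemma D3_quadratic_form:
  fixes F :: "real^'n \<Rightarrow> real"
  assumes "(hess F has_derivative D) (at x)"
  shows "((\<lambda>y. (hess F y *v u) \<bullet> u) has_derivative (\<lambda>w. (D3 F x w *v u) \<bullet> u)) (at x)"
proof -
  have "D3 F x w = D w" for w
    unfolding D3_def
    by (rule tendsto_Lim[OF _ tendsto_directional_difference_quotient[OF assms]]) simp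
  then show ?thesis
    using bounded_linear.has_derivative[OF bounded_linear_quadratic_form[of u] assms] by simp
qed

lemma has_derivative_along_line:
  fixes H :: "'a::real_normed_vector \<Rightarrow> real"
  assumes "(H has_derivative D) (at (x + t *\<^sub>R d))"
  shows "((\<lambda>t. H (x + t *\<^sub>R d)) has_real_derivative D d) (at t)"
proof -
  have "((\<lambda>\<alpha>::real. x + \<alpha> *\<^sub>R d) has_derivative (\<lambda>\<alpha>. \<alpha> *\<^sub>R d)) (at t)"
    by (auto intro!: derivative_eq_intros)
  then have "((\<lambda>\<alpha>. H (x + \<alpha> *\<^sub>R d)) has_derivative (\<lambda>\<alpha>. D (\<alpha> *\<^sub>R d))) (at t)"
    by (rule has_derivative_compose) (use assms in simp)
  moreover have "(\<lambda>\<alpha>. D (\<alpha> *\<^sub>R d)) = (*) (D d)"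
    by (auto simp: linear_scale[OF has_derivative_linear[OF assms]])
  ultimately show ?thesis by (simp add: has_field_derivative_def)
qed

lemma C3_differentiable:
  fixes F :: "real^'n \<Rightarrow> real"
  assumes "open S" "Ck_on 3 F S" "x \<in> S"
  shows "F differentiable (at x)"
    and "(grad F has_derivative (\<lambda>h. hess F x *v h)) (at x)"
    and "hess F differentiable (at x)"
proof -
  have Ck: "\<And>y. y \<in> S \<Longrightarrow> F differentiable (at y)"
    "\<And>y v. y \<in> S \<Longrightarrow> (\<lambda>y. frechet_derivative F (at y) v) differentiable (at y)"
    "\<And>y u v. y \<in> S \<Longrightarrow> (\<lambda>y. frechet_derivative (\<lambda>y. frechet_derivative F (at y) v) (at y) u)
        differentiable (at y)"
    using assms(2) by (auto simp: numeral_3_eq_3)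
  show "F differentiable (at x)" using Ck assms by blast
  show "(grad F has_derivative (\<lambda>h. hess F x *v h)) (at x)"
    by (rule hess_has_derivative[OF assms(1,3)]) (use Ck assms in auto)
  show "hess F differentiable (at x)"
    by (rule hess_differentiable[OF assms(1,3)]) (use Ck assms in auto)
qed

lemma derivatives_along_line:
  fixes F :: "real^'n \<Rightarrow> real"
  assumes "open S" "Ck_on 3 F S" "x + t *\<^sub>R d \<in> S"
  shows "((\<lambda>t. F (x + t *\<^sub>R d)) has_real_derivative grad F (x + t *\<^sub>R d) \<bullet> d) (at t)"
    and "((\<lambda>t. grad F (x + t *\<^sub>R d) \<bullet> d) has_real_derivative (hess F (x + t *\<^sub>R d) *v d) \<bullet> d) (at t)"
    and "((\<lambda>t. (hess F (x + t *\<^sub>R d) *v d) \<bullet> d) has_real_derivative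
            (D3 F (x + t *\<^sub>R d) d *v d) \<bullet> d) (at t)"
proof -
  note C3 = C3_differentiable[OF assms]
  show "((\<lambda>t. F (x + t *\<^sub>R d)) has_real_derivative grad F (x + t *\<^sub>R d) \<bullet> d) (at t)"
    unfolding grad_inner[OF C3(1)]
    by (rule has_derivative_along_line) (use C3(1) frechet_derivative_works in blast)
  show "((\<lambda>t. grad F (x + t *\<^sub>R d) \<bullet> d) has_real_derivative (hess F (x + t *\<^sub>R d) *v d) \<bullet> d) (at t)"
    by (rule has_derivative_along_line[where H = "\<lambda>y. grad F y \<bullet> d"])
       (intro has_derivative_inner_left C3(2))
  obtain D where "(hess F has_derivative D) (at (x + t *\<^sub>R d))"
    using C3(3) by (auto simp: differentiable_def)
  from D3_quadratic_form[OF this, of d]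
  show "((\<lambda>t. (hess F (x + t *\<^sub>R d) *v d) \<bullet> d) has_real_derivative
            (D3 F (x + t *\<^sub>R d) d *v d) \<bullet> d) (at t)"
    by (rule has_derivative_along_line[where H = "\<lambda>y. (hess F y *v d) \<bullet> d"])
qed

section \<open>First- and second-order consequences of convexity\<close>

text \<open>Adding the tangent inequalities at two points shows that \<open>\<phi>1\<close> is
  monotone, so its difference quotients, and hence their limit, are nonnegative.\<close>

lemma convex_on_imp_second_derivative_nonneg:
  fixes \<phi> \<phi>1 :: "real \<Rightarrow> real"
  assumes A: "open A" and conv: "convex_on A \<phi>" and t: "t \<in> A"
    and d: "\<And>s. s \<in> A \<Longrightarrow> (\<phi> has_real_derivative \<phi>1 s) (at s)"
    and d2: "(\<phi>1 has_real_derivative c) (at t)"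
  shows "c \<ge> 0"
proof -
  have conn: "connected A" using conv by (auto simp: convex_on_def intro: convex_connected)
  have tangent: "\<phi>1 r * (s - r) \<le> \<phi> s - \<phi> r" if "r \<in> A" "s \<in> A" for r s
    by (rule convex_on_imp_above_tangent[OF conv conn])
       (use that A d in \<open>auto simp: interior_open intro: has_field_derivative_at_within\<close>)
  have "((\<lambda>y. (\<phi>1 y - \<phi>1 t) / (y - t)) \<longlongrightarrow> c) (at t)"
    using d2 by (simp add: has_field_derivative_iff)
  moreover have "eventually (\<lambda>y. y \<in> A) (at t)"
    using A t by (simp add: eventually_at_in_open')
  then have "eventually (\<lambda>y. 0 \<le> (\<phi>1 y - \<phi>1 t) / (y - t)) (at t)"
  proof eventually_elim
    case (elim y)
    have "0 \<le> (\<phi>1 y - \<phi>1 t) * (y - t)"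
      using tangent[OF elim t] tangent[OF t elim] by (simp add: algebra_simps)
    then show ?case by (simp add: zero_le_mult_iff zero_le_divide_iff)
  qed
  ultimately show ?thesis by (intro tendsto_lowerbound) auto
qed

lemma convex_on_line:
  fixes F :: "'a::real_normed_vector \<Rightarrow> real"
  assumes "convex_on S F"
  shows "convex_on {t. x + t *\<^sub>R d \<in> S} (\<lambda>t. F (x + t *\<^sub>R d))"
proof -
  have eq: "x + (u * s + v * t) *\<^sub>R d = u *\<^sub>R (x + s *\<^sub>R d) + v *\<^sub>R (x + t *\<^sub>R d)"
    if "u + v = 1" for u v s t
    using that by (simp add: algebra_simps flip: scaleR_add_left)
  show ?thesis
    using assms unfolding convex_on_def convex_def by (auto simp: eq)
qed

lemma open_line_preimage:
  fixes S :: "'a::real_normed_vector set"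
  assumes "open S"
  shows "open {t::real. x + t *\<^sub>R d \<in> S}"
  using open_vimage[OF assms, of "\<lambda>t::real. x + t *\<^sub>R d"] by (simp add: vimage_def continuous_intros)

text \<open>Reduces to one variable: the restriction to the line through \<open>x\<close> and
  \<open>y\<close> is convex on an open set of parameters containing 0 and 1.\<close>

lemma convex_C3_tangent:
  fixes F :: "real^'n \<Rightarrow> real"
  assumes S: "open S" "Ck_on 3 F S" "convex_on S F" and xy: "x \<in> S" "y \<in> S"
  shows "F x + grad F x \<bullet> (y - x) \<le> F y"
proof -
  let ?A = "{t. x + t *\<^sub>R (y - x) \<in> S}"
  have conv: "convex_on ?A (\<lambda>t. F (x + t *\<^sub>R (y - x)))" by (rule convex_on_line[OF S(3)])
  have "((\<lambda>t. F (x + t *\<^sub>R (y - x))) has_real_derivative grad F (x + 0 *\<^sub>R (y - x)) \<bullet> (y - x)) (at 0 within ?A)"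
    by (rule has_field_derivative_at_within[OF derivatives_along_line(1)[OF S(1,2), of x 0 "y - x"]]) (use xy in simp)
  moreover have "0 \<in> interior ?A" "1 \<in> ?A"
    using xy by (simp_all add: interior_open[OF open_line_preimage[OF S(1)]])
  moreover have "connected ?A" using conv by (simp add: convex_on_def convex_connected)
  ultimately have "grad F (x + 0 *\<^sub>R (y - x)) \<bullet> (y - x) * (1 - 0)
      \<le> F (x + 1 *\<^sub>R (y - x)) - F (x + 0 *\<^sub>R (y - x))"
    using convex_on_imp_above_tangent[OF conv] by blast
  then show ?thesis by simp
qed

lemma convex_C3_hess_nonneg:
  fixes F :: "real^'n \<Rightarrow> real"
  assumes S: "open S" "Ck_on 3 F S" "convex_on S F" and x: "x \<in> S"
  shows "(hess F x *v d) \<bullet> d \<ge> 0"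
proof -
  have "(hess F (x + 0 *\<^sub>R d) *v d) \<bullet> d \<ge> 0"
    by (rule convex_on_imp_second_derivative_nonneg[OF open_line_preimage[OF S(1)] convex_on_line[OF S(3), of x d]
            _ derivatives_along_line(1)[OF S(1,2)] derivatives_along_line(2)[OF S(1,2)]])
       (use x in simp_all)
  then show ?thesis by simp
qed

section \<open>Descent for generalized self-concordant functions\<close>

text \<open>The sublevel set is a horizontal slice of the closed epigraph.\<close>

lemma closed_sublevel:
  fixes f :: "'a::real_normed_vector \<Rightarrow> ereal"
  assumes "closed_convex_fun f"
  shows "closed {x. f x \<le> ereal r}"
proof -
  have "closed ((\<lambda>x. (x, r)) -` {(x, r :: real). f x \<le> ereal r})"
    using assms by (intro continuous_closed_vimage) (auto simp: closed_convex_fun_def intro!: continuous_intros)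
  then show ?thesis by (simp add: vimage_def)
qed

lemma edom_ereal_fin:
  assumes "closed_convex_fun f" "x \<in> edom f"
  shows "f x = ereal (fin f x)"
  using assms by (cases "f x") (auto simp: closed_convex_fun_def edom_def fin_def)

text \<open>The constant \<open>M\<close> is not assumed to be nonnegative, hence \<open>max M 0\<close>.\<close>

lemma gsc_third_derivative_along_line:
  fixes f :: "real^'n \<Rightarrow> ereal" and y d :: "real^'n"
  assumes gsc: "gen_self_concordant M \<nu> f" and \<nu>: "\<nu> \<ge> 2" and y: "y \<in> edom f"
  defines "Q \<equiv> (hess (fin f) y *v d) \<bullet> d"
  shows "(D3 (fin f) y d *v d) \<bullet> d \<le> max M 0 * rpow (norm d) (3 - \<nu>) * Q powr (\<nu> / 2)"
proof -
  have Q: "Q \<ge> 0"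
    unfolding Q_def using gsc y
    by (intro convex_C3_hess_nonneg[of "edom f"]) (auto simp: gen_self_concordant_def closed_convex_fun_def)
  have r: "rpow (norm d) (3 - \<nu>) \<ge> 0" by (simp add: rpow_def)
  \<comment> \<open>With \<open>u = w = d\<close> the exponents 2 and \<open>\<nu> - 2\<close> of
    the local norm add up to \<nu>, and the local norm is the square root of
    \<open>Q\<close>.\<close>
  have "(mnorm (hess (fin f) y) d)\<^sup>2 * rpow (mnorm (hess (fin f) y) d) (\<nu> - 2) = Q powr (\<nu> / 2)"
  proof (cases "\<nu> = 2")
    case True
    then show ?thesis using Q by (simp add: mnorm_def rpow_def flip: Q_def)
  next
    case False
    have "sqrt Q powr (\<nu> - 2) = Q powr (\<nu> / 2 - 1)"
      using Q by (simp add: powr_powr diff_divide_distrib flip: powr_half_sqrt)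
    moreover have "Q * Q powr (\<nu> / 2 - 1) = Q powr (\<nu> / 2)"
      using Q by (cases "Q = 0") (simp_all add: powr_mult_base)
    ultimately show ?thesis using False Q by (simp add: mnorm_def rpow_def flip: Q_def)
  qed
  moreover have "\<bar>(D3 (fin f) y d *v d) \<bullet> d\<bar> \<le> M * (mnorm (hess (fin f) y) d)\<^sup>2
      * rpow (mnorm (hess (fin f) y) d) (\<nu> - 2) * rpow (norm d) (3 - \<nu>)"
    using gsc y by (simp add: gen_self_concordant_def)
  ultimately have "(D3 (fin f) y d *v d) \<bullet> d \<le> M * (rpow (norm d) (3 - \<nu>) * Q powr (\<nu> / 2))"
    by (simp add: mult_ac)
  also have "\<dots> \<le> max M 0 * (rpow (norm d) (3 - \<nu>) * Q powr (\<nu> / 2))"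
    using r by (intro mult_right_mono) auto
  finally show ?thesis by (simp add: mult_ac)
qed

text \<open>The set of parameters for which the segment lies in the domain is relatively open because the
  domain is, and relatively closed because the upper bound confines it to a sublevel set.\<close>

lemma gsc_descent:
  fixes f :: "real^'n \<Rightarrow> ereal" and x d :: "real^'n"
  assumes gsc: "gen_self_concordant M \<nu> f" and \<nu>: "\<nu> \<ge> 2" and x: "x \<in> edom f"
  defines "Q \<equiv> (hess (fin f) x *v d) \<bullet> d" and "K \<equiv> max M 0 * rpow (norm d) (3 - \<nu>)"
  assumes small: "if \<nu> = 2 then K \<le> 1 / 2 else (\<nu> / 2 - 1) * K * Q powr (\<nu> / 2 - 1) \<le> 1 / 2"
  shows "x + d \<in> edom f"
    and "fin f (x + d) \<le> fin f x + grad (fin f) x \<bullet> d + Q * omega \<nu> (1/2)"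
proof -
  define S where "S = edom f"
  define F where "F = fin f"
  have S: "open S" "Ck_on 3 F S" "convex_on S F" and cl: "closed_convex_fun f"
    using gsc by (auto simp: gen_self_concordant_def closed_convex_fun_def S_def F_def)
  define A where "A = {t::real. x + t *\<^sub>R d \<in> S}"
  define \<phi>2 where "\<phi>2 = (\<lambda>t. (hess F (x + t *\<^sub>R d) *v d) \<bullet> d)"
  have openA: "open A" unfolding A_def by (rule open_line_preimage[OF S(1)])
  have convA: "convex A"
    using convex_on_line[OF S(3), of x d] by (simp add: A_def convex_on_def)
  have "0 \<in> A" using x by (simp add: A_def S_def)
  have nn: "\<phi>2 t \<ge> 0" if "t \<in> A" for t
    using that convex_C3_hess_nonneg[OF S] by (simp add: \<phi>2_def A_def)
  have K: "K \<ge> 0" by (simp add: K_def rpow_def)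
  have Q: "\<phi>2 0 = Q" by (simp add: \<phi>2_def Q_def F_def)
  obtain G G1 where G: "G 0 = 0" "G1 0 = 0" "G 1 = omega \<nu> (1/2)"
    "\<And>t. t \<in> {0..1} \<Longrightarrow> (G has_real_derivative G1 t) (at t)"
    "\<And>t. t \<in> {0..1} \<Longrightarrow> (G1 has_real_derivative gsc_majorant \<nu> t) (at t)"
    using omega_half_antiderivative[OF \<nu>] by metis
  have bound: "F (x + t *\<^sub>R d) \<le> F x + grad F x \<bullet> d * t + Q * G t" if t: "t \<in> A" "0 \<le> t" "t \<le> 1" for t
  proof -
    \<comment> \<open>The set of admissible parameters is convex and contains 0, so the estimate can
      be run up to any admissible \<open>t\<close> before the whole step is known to stay in the
      domain.\<close>
    have sub: "s \<in> A" if "s \<in> {0..t}" for s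
      using mem_is_interval_1_I[OF convA[folded is_interval_convex_1] \<open>0 \<in> A\<close> t(1)] that by auto
    have "F (x + t *\<^sub>R d) \<le> F (x + 0 *\<^sub>R d) + grad F (x + 0 *\<^sub>R d) \<bullet> d * t + Q * G t"
    proof (rule second_order_comparison[where \<phi> = "\<lambda>t. F (x + t *\<^sub>R d)"
          and ?\<phi>1.0 = "\<lambda>t. grad F (x + t *\<^sub>R d) \<bullet> d" and ?\<phi>2.0 = \<phi>2 and G = G and ?G1.0 = G1
          and g = "gsc_majorant \<nu>"])
      fix s assume s: "s \<in> {0..t}"
      have sS: "x + s *\<^sub>R d \<in> S" using sub[OF s] by (simp add: A_def)
      show "((\<lambda>t. F (x + t *\<^sub>R d)) has_real_derivative grad F (x + s *\<^sub>R d) \<bullet> d) (at s)"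
        by (rule derivatives_along_line(1)[OF S(1,2) sS])
      show "((\<lambda>t. grad F (x + t *\<^sub>R d) \<bullet> d) has_real_derivative \<phi>2 s) (at s)"
        unfolding \<phi>2_def by (rule derivatives_along_line(2)[OF S(1,2) sS])
      have "\<phi>2 s \<le> \<phi>2 0 * gsc_majorant \<nu> s"
      proof (rule gsc_second_derivative_bound[OF \<nu>, where K = K])
        fix r assume "r \<in> {0..s}"
        then have "r \<in> {0..t}" using s by auto
        then have r: "r \<in> A" by (rule sub)
        then have rS: "x + r *\<^sub>R d \<in> S" by (simp add: A_def)
        show "(\<phi>2 has_real_derivative (D3 F (x + r *\<^sub>R d) d *v d) \<bullet> d) (at r)"
          unfolding \<phi>2_def by (rule derivatives_along_line(3)[OF S(1,2) rS])
        show "\<phi>2 r \<ge> 0" by (rule nn[OF r])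
        show "(D3 F (x + r *\<^sub>R d) d *v d) \<bullet> d \<le> K * \<phi>2 r powr (\<nu> / 2)"
          unfolding K_def \<phi>2_def F_def
          by (rule gsc_third_derivative_along_line[OF gsc \<nu>]) (use rS in \<open>simp add: S_def\<close>)
      qed (use s t K small Q in auto)
      then show "\<phi>2 s \<le> Q * gsc_majorant \<nu> s" using Q by simp
    qed (use t G in auto)
    then show ?thesis by simp
  qed
  \<comment> \<open>A level independent of \<open>t\<close>, so that a single closed sublevel set
    captures all admissible parameters in [0,1]. It works because \<open>G\<close> is nondecreasing
    with final value \<open>omega \<nu> (1/2)\<close>.\<close>
  define C where "C = F x + \<bar>grad F x \<bullet> d\<bar> + Q * omega \<nu> (1/2)"
  have G1_nonneg: "G1 s \<ge> 0" if "s \<in> {0..1}" for s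
  proof -
    have "G1 0 \<le> G1 s"
      by (rule DERIV_nonneg_imp_nondecreasing[where f = G1])
         (use that in \<open>auto intro!: exI[of _ "gsc_majorant \<nu> _"] G gsc_majorant_nonneg\<close>)
    then show ?thesis using G by simp
  qed
  have G_le: "G s \<le> omega \<nu> (1/2)" if "s \<in> {0..1}" for s
  proof -
    have "G s \<le> G 1"
      by (rule DERIV_nonneg_imp_nondecreasing[where f = G])
         (use that in \<open>auto intro!: exI[of _ "G1 _"] G G1_nonneg\<close>)
    then show ?thesis using G by simp
  qed
  \<comment> \<open>Left to right is the upper bound just derived; right to left, a value below the
    real level \<open>C\<close> is finite and so puts the point in the domain.\<close>
  have eq: "{0..1} \<inter> A = {0..1} \<inter> (\<lambda>t. x + t *\<^sub>R d) -` {y. f y \<le> ereal C}"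
  proof (intro equalityI subsetI)
    fix t assume t: "t \<in> {0..1} \<inter> A"
    have "F (x + t *\<^sub>R d) \<le> F x + grad F x \<bullet> d * t + Q * G t" using bound t by auto
    also have "grad F x \<bullet> d * t \<le> \<bar>grad F x \<bullet> d\<bar> * 1"
      using t by (intro mult_mono) auto
    also have "Q * G t \<le> Q * omega \<nu> (1/2)"
      using nn[OF \<open>0 \<in> A\<close>] Q G_le t by (intro mult_left_mono) auto
    finally have "F (x + t *\<^sub>R d) \<le> C" by (simp add: C_def)
    moreover have "f (x + t *\<^sub>R d) = ereal (F (x + t *\<^sub>R d))"
      using edom_ereal_fin[OF cl] t by (simp add: A_def S_def F_def)
    ultimately show "t \<in> {0..1} \<inter> (\<lambda>t. x + t *\<^sub>R d) -` {y. f y \<le> ereal C}" using t by simp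
  qed (auto simp: A_def S_def edom_def intro: le_less_trans)
  have "closed ({0..1} \<inter> (\<lambda>t. x + t *\<^sub>R d) -` {y. f y \<le> ereal C})"
    by (intro closed_Int continuous_closed_vimage closed_sublevel[OF cl]) (auto intro!: continuous_intros)
  then have "closedin (top_of_set {0..1}) ({0..1} \<inter> A)"
    unfolding eq by (simp add: closed_subset)
  moreover have "openin (top_of_set {0..1}) ({0..1} \<inter> A)"
    using openA by (rule openin_open_Int)
  moreover have "connected {0..1::real}" by simp
  moreover have "0 \<in> {0..1} \<inter> A" using \<open>0 \<in> A\<close> by simp
  ultimately have "{0..1} \<inter> A = {0..1}" unfolding connected_clopen by blast
  then have "1 \<in> A" by (metis IntD2 atLeastAtMost_iff order_refl zero_le_one)
  then show "x + d \<in> edom f" by (simp add: A_def S_def)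
  show "fin f (x + d) \<le> fin f x + grad (fin f) x \<bullet> d + Q * omega \<nu> (1/2)"
    using bound[OF \<open>1 \<in> A\<close>] G by (simp add: F_def)
qed

section \<open>The curvature constant of a compact subset of the domain\<close>

text \<open>A real supremum is an upper bound only for a set bounded above. Here boundedness comes
  from continuity of the Hessian on the compact set \<open>C\<close>.\<close>

lemma hess_le_Lf:
  fixes f :: "real^'n \<Rightarrow> ereal"
  assumes gsc: "gen_self_concordant M \<nu> f" and C: "compact C" "C \<subseteq> edom f" and u: "u \<in> C"
  shows "(hess (fin f) u *v d) \<bullet> d \<le> Lf f C * (norm d)\<^sup>2"
proof (cases "d = 0")
  case False
  let ?H = "hess (fin f)"
  let ?R = "{(mnorm (?H u) d)\<^sup>2 / (norm d)\<^sup>2 | u d. u \<in> C \<and> d \<noteq> 0}"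
  have S: "open (edom f)" "Ck_on 3 (fin f) (edom f)" "convex_on (edom f) (fin f)"
    using gsc by (auto simp: gen_self_concordant_def closed_convex_fun_def)
  have "continuous_on C ?H"
    using C C3_differentiable(3)[OF S(1,2)]
    by (intro differentiable_imp_continuous_on) (auto simp: differentiable_on_def intro: differentiable_at_withinI)
  then have "bounded (?H ` C)" using C compact_continuous_image compact_imp_bounded by blast
  then obtain b where b: "\<And>u. u \<in> C \<Longrightarrow> norm (?H u) \<le> b" by (auto simp: bounded_iff)
  have quot: "(mnorm (?H u) d)\<^sup>2 = (?H u *v d) \<bullet> d" if "u \<in> C" for u d
    using convex_C3_hess_nonneg[OF S] that C by (auto simp: mnorm_def)
  \<comment> \<open>The dimension factor comes from bounding the Euclidean norm by the sum of
    coordinates, each estimated by Cauchy-Schwarz. The crude constant suffices, as only boundedness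
    is at stake.\<close>
  have "(mnorm (?H u) d)\<^sup>2 / (norm d)\<^sup>2 \<le> real CARD('n) * b" if u: "u \<in> C" and d: "d \<noteq> 0" for u d
  proof -
    have "norm (?H u *v d) \<le> (\<Sum>i\<in>UNIV. \<bar>(?H u *v d) $ i\<bar>)" by (rule norm_le_l1_cart)
    also have "\<dots> \<le> (\<Sum>i\<in>(UNIV::'n set). b * norm d)"
    proof (rule sum_mono)
      fix i
      have "\<bar>(?H u *v d) $ i\<bar> \<le> norm (?H u $ i) * norm d"
        by (simp add: matrix_vector_mul_component Cauchy_Schwarz_ineq2)
      also have "\<dots> \<le> b * norm d"
        by (intro mult_right_mono order_trans[OF Finite_Cartesian_Product.norm_nth_le b[OF u]]) auto
      finally show "\<bar>(?H u *v d) $ i\<bar> \<le> b * norm d" .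
    qed
    finally have "norm (?H u *v d) \<le> real CARD('n) * b * norm d" by simp
    then have "(?H u *v d) \<bullet> d \<le> real CARD('n) * b * norm d * norm d"
      by (intro order_trans[OF norm_cauchy_schwarz] mult_right_mono) auto
    then have "(mnorm (?H u) d)\<^sup>2 \<le> real CARD('n) * b * (norm d)\<^sup>2"
      unfolding quot[OF u] by (simp add: power2_eq_square mult_ac)
    then show ?thesis using d by (simp add: pos_divide_le_eq)
  qed
  then have "bdd_above ?R" by (intro bdd_aboveI[of _ "real CARD('n) * b"]) auto
  then have "(mnorm (?H u) d)\<^sup>2 / (norm d)\<^sup>2 \<le> Lf f C"
    unfolding Lf_def by (intro cSup_upper) (use u False in auto)
  then show ?thesis using False by (simp add: quot[OF u] pos_divide_le_eq)
qed simp

text \<open>Because \<open>f x0\<close> is finite, the level condition already forces membership in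
  the domain, so the set is \<open>X\<close> cut by a closed sublevel set.\<close>

lemma compact_initial_level_set:
  fixes f :: "real^'n \<Rightarrow> ereal"
  assumes "closed_convex_fun f" "compact X" "x0 \<in> edom f"
  shows "compact (initial_level_set f X x0)"
proof -
  have "initial_level_set f X x0 = X \<inter> {y. f y \<le> ereal (fin f x0)}"
    using edom_ereal_fin[OF assms(1,3)] assms(3) by (auto simp: initial_level_set_def edom_def)
  then show ?thesis using assms closed_sublevel by (auto intro: compact_Int_closed)
qed

lemma Lf_nonneg:
  fixes f :: "real^'n \<Rightarrow> ereal"
  assumes gsc: "gen_self_concordant M \<nu> f" and C: "compact C" "C \<subseteq> edom f" "u \<in> C"
  shows "Lf f C \<ge> 0"
proof -
  define e :: "real^'n" where "e = axis undefined 1"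
  have "norm e = 1" by (simp add: e_def)
  moreover have "0 \<le> (hess (fin f) u *v e) \<bullet> e"
    using gsc C by (intro convex_C3_hess_nonneg[of "edom f"]) (auto simp: gen_self_concordant_def closed_convex_fun_def)
  ultimately show ?thesis using hess_le_Lf[OF gsc C, of e] by simp
qed

text \<open>Truncation at 0 only enlarges the index, so the real bound survives; the 2 subtracted in
  \<open>T_idx\<close> matches the \<open>t + 2\<close> in the step size.\<close>

lemma le_of_nat_ceiling_le:
  fixes z :: real
  assumes "nat (\<lceil>z\<rceil> - 2) \<le> t"
  shows "z \<le> real t + 2"
proof -
  have "\<lceil>z\<rceil> \<le> int t + 2" using assms by linarith
  then show ?thesis by (simp add: ceiling_le_iff)
qed

section \<open>Monotonic Frank-Wolfe\<close>

text \<open>The reason for the form of \<open>T_idx\<close>: from that index on, the factor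
  \<open>2 / (t + 2)\<close> makes the step short enough for the smallness condition of the descent
  lemma.\<close>

lemma FW_step_size_small:
  fixes d :: "'a::real_normed_vector"
  assumes \<nu>: "\<nu> \<ge> 2" and L: "L \<ge> 0" and Q: "0 \<le> Q" "Q \<le> L * (norm d)\<^sup>2"
    and d: "norm d \<le> 2 / (real t + 2) * D" and t: "T_idx M \<nu> D L \<le> t"
  defines "K \<equiv> max M 0 * rpow (norm d) (3 - \<nu>)"
  shows "if \<nu> = 2 then K \<le> 1 / 2 else (\<nu> / 2 - 1) * K * Q powr (\<nu> / 2 - 1) \<le> 1 / 2"
proof -
  have "0 \<le> 2 / (real t + 2) * D" using d norm_ge_zero order_trans by blast
  then have D: "D \<ge> 0" by (simp add: zero_le_mult_iff zero_le_divide_iff)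
  have key: "c * norm d \<le> 1 / 2" if c: "0 \<le> c" "4 * c * D \<le> real t + 2" for c
  proof -
    have "c * norm d \<le> c * (2 / (real t + 2) * D)" using c d by (intro mult_left_mono)
    also have "\<dots> \<le> 1 / 2" using c by (simp add: field_simps)
    finally show ?thesis .
  qed
  \<comment> \<open>For negative \<open>M\<close> the left-hand side is 0, so passing to
    \<open>max M 0\<close> costs nothing.\<close>
  have max_le: "a * max M 0 * b \<le> real t + 2" if "a * M * b \<le> real t + 2" for a b
    using that by (cases "M \<ge> 0") (simp_all add: max_def)
  show ?thesis
  proof (cases "\<nu> = 2")
    case True
    have "4 * M * D \<le> real t + 2"
      using t True by (intro le_of_nat_ceiling_le) (simp add: T_idx_def)
    then have "4 * max M 0 * D \<le> real t + 2" by (rule max_le)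
    then have "max M 0 * norm d \<le> 1 / 2" by (intro key) auto
    then show ?thesis using True by (simp add: K_def rpow_def)
  next
    case False
    define q where "q = \<nu> / 2 - 1"
    have q: "q > 0" using False \<nu> by (simp add: q_def)
    have "2 * M * D * L powr q * (\<nu> - 2) \<le> real t + 2"
      using t False by (intro le_of_nat_ceiling_le) (simp add: T_idx_def q_def)
    then have "2 * M * (D * L powr q * (\<nu> - 2)) \<le> real t + 2" by (simp only: mult_ac)
    then have "2 * max M 0 * (D * L powr q * (\<nu> - 2)) \<le> real t + 2" by (rule max_le)
    moreover have eq: "\<nu> - 2 = 2 * q" by (simp add: q_def)
    ultimately have "4 * (q * max M 0 * L powr q) * D \<le> real t + 2" unfolding eq by (simp add: mult_ac)
    then have *: "q * max M 0 * L powr q * norm d \<le> 1 / 2" using q by (intro key) auto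
    have "Q powr q \<le> (L * (norm d)\<^sup>2) powr q" using Q q by (intro powr_mono2) auto
    also have "(norm d)\<^sup>2 = norm d powr 2" by (simp add: powr_numeral)
    also have "(L * norm d powr 2) powr q = L powr q * norm d powr (\<nu> - 2)"
      using L eq by (simp add: powr_mult powr_powr del: powr_numeral)
    finally have "q * K * Q powr q \<le> q * K * (L powr q * norm d powr (\<nu> - 2))"
      using q by (intro mult_left_mono) (auto simp: K_def rpow_def)
    \<comment> \<open>The power \<open>3 - \<nu>\<close> from \<open>K\<close> and the power
      \<open>\<nu> - 2\<close> from the curvature bound cancel to a single factor
      \<open>norm d\<close>, which the step size controls. For \<open>d = 0\<close> both sides are
      0.\<close>
    also have "rpow (norm d) (3 - \<nu>) * norm d powr (\<nu> - 2) = norm d"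
      by (cases "d = 0") (auto simp: rpow_def simp flip: powr_add)
    then have "q * K * (L powr q * norm d powr (\<nu> - 2)) = q * max M 0 * L powr q * norm d"
      by (simp add: K_def mult_ac)
    also note *
    finally show ?thesis using False by (simp add: q_def)
  qed
qed

text \<open>Applies the descent lemma to \<open>d = \<gamma> (v - x)\<close>. Curvature enters only
  at the starting point \<open>x\<close>, which lies in the initial level set, so the constant of
  that set suffices even if the step leaves it. Optimality of \<open>v\<close> and the tangent
  inequality at \<open>xstar\<close> bound the linear term by
  \<open>- \<gamma> h(x)\<close>.\<close>

lemma FW_step:
  fixes f :: "real^'n \<Rightarrow> ereal"
  assumes gsc: "gen_self_concordant M \<nu> f" and \<nu>: "\<nu> \<ge> 2"
    and X: "compact X" and x0: "x0 \<in> X \<inter> edom f"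
    and x: "x \<in> initial_level_set f X x0"
    and xstar: "xstar \<in> X" "xstar \<in> edom f"
    and v: "is_arg_min (\<lambda>y. grad (fin f) x \<bullet> y) (\<lambda>y. y \<in> X) v"
    and t: "T_idx M \<nu> (diameter X) (Lf f (initial_level_set f X x0)) \<le> t"
  defines "\<gamma> \<equiv> 2 / (real t + 2)"
  defines "y \<equiv> x + \<gamma> *\<^sub>R (v - x)"
  shows "y \<in> edom f"
    and "primal_gap f xstar y \<le> (1 - \<gamma>) * primal_gap f xstar x
           + \<gamma>\<^sup>2 * (Lf f (initial_level_set f X x0) * (diameter X)\<^sup>2 * omega \<nu> (1/2))"
proof -
  define C where "C = initial_level_set f X x0"
  define L where "L = Lf f C"
  define D where "D = diameter X"
  define d where "d = \<gamma> *\<^sub>R (v - x)"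
  define Q where "Q = (hess (fin f) x *v d) \<bullet> d"
  have S: "open (edom f)" "Ck_on 3 (fin f) (edom f)" "convex_on (edom f) (fin f)" "closed_convex_fun f"
    using gsc by (auto simp: gen_self_concordant_def closed_convex_fun_def)
  have C: "compact C" "C \<subseteq> edom f" "x \<in> C"
    using compact_initial_level_set[OF S(4) X] x0 x by (auto simp: C_def initial_level_set_def)
  have xX: "x \<in> X" "x \<in> edom f" using x by (auto simp: initial_level_set_def)
  have vX: "v \<in> X" "grad (fin f) x \<bullet> v \<le> grad (fin f) x \<bullet> xstar"
    using v xstar by (auto simp: is_arg_min_linorder)
  have \<gamma>: "\<gamma> \<ge> 0" by (simp add: \<gamma>_def)
  have L: "L \<ge> 0" unfolding L_def by (rule Lf_nonneg[OF gsc C])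
  have Q: "0 \<le> Q" "Q \<le> L * (norm d)\<^sup>2"
    unfolding Q_def L_def
    using convex_C3_hess_nonneg[OF S(1-3) xX(2)] hess_le_Lf[OF gsc C] by auto
  have "norm (v - x) \<le> D"
    using diameter_bounded_bound[OF compact_imp_bounded[OF X] vX(1) xX(1)] by (simp add: D_def dist_norm)
  then have d: "norm d \<le> \<gamma> * D" using \<gamma> by (simp add: d_def mult_left_mono)
  have small: "if \<nu> = 2 then max M 0 * rpow (norm d) (3 - \<nu>) \<le> 1 / 2
      else (\<nu> / 2 - 1) * (max M 0 * rpow (norm d) (3 - \<nu>)) * Q powr (\<nu> / 2 - 1) \<le> 1 / 2"
    by (rule FW_step_size_small[OF \<nu> L Q d[unfolded \<gamma>_def]]) (use t in \<open>simp add: L_def C_def D_def\<close>)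
  note descent = gsc_descent[OF gsc \<nu> xX(2) small[unfolded Q_def]]
  show "y \<in> edom f" using descent(1) by (simp add: y_def d_def)
  have "Q \<le> L * (\<gamma> * D)\<^sup>2"
    using Q(2) d L by (intro order_trans[OF Q(2)] mult_left_mono power_mono) auto
  then have "Q * omega \<nu> (1/2) \<le> L * (\<gamma> * D)\<^sup>2 * omega \<nu> (1/2)"
    using omega_half_nonneg[OF \<nu>] by (rule mult_right_mono)
  moreover have "grad (fin f) x \<bullet> (v - x) \<le> - primal_gap f xstar x"
    using convex_C3_tangent[OF S(1-3) xX(2) xstar(2)] vX(2) by (simp add: primal_gap_def inner_diff_right)
  then have "grad (fin f) x \<bullet> d \<le> \<gamma> * (- primal_gap f xstar x)"
    using \<gamma> unfolding d_def inner_scaleR_right by (rule mult_left_mono)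
  moreover have "fin f y \<le> fin f x + grad (fin f) x \<bullet> d + Q * omega \<nu> (1/2)"
    using descent(2) by (simp add: y_def d_def Q_def)
  ultimately have "primal_gap f xstar y
      \<le> primal_gap f xstar x + \<gamma> * (- primal_gap f xstar x) + L * (\<gamma> * D)\<^sup>2 * omega \<nu> (1/2)"
    by (simp add: primal_gap_def)
  also have "\<dots> = (1 - \<gamma>) * primal_gap f xstar x + \<gamma>\<^sup>2 * (L * D\<^sup>2 * omega \<nu> (1/2))"
    by (simp add: algebra_simps power_mult_distrib)
  finally show "primal_gap f xstar y \<le> (1 - \<gamma>) * primal_gap f xstar x
           + \<gamma>\<^sup>2 * (Lf f (initial_level_set f X x0) * (diameter X)\<^sup>2 * omega \<nu> (1/2))"
    by (simp add: L_def C_def D_def)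
qed

text \<open>Induction from \<open>T\<close>, where the factor 4 leaves slack. With
  \<open>E = 4 (T + 1) C\<close>, the quadratic term is at most \<open>E / (t + 2)\<^sup>2\<close>
  because \<open>4 C \<le> E\<close>, and what remains is
  \<open>t / (t + 1) + 1 / (t + 2) \<le> 1\<close>.\<close>

lemma FW_recursion_rate:
  fixes h :: "nat \<Rightarrow> real"
  assumes C: "C \<ge> 0" and hT: "h T \<le> C"
    and step: "\<And>t. T \<le> t \<Longrightarrow> h (Suc t) \<le> (1 - 2 / (real t + 2)) * h t + (2 / (real t + 2))\<^sup>2 * C"
    and t: "T \<le> t"
  shows "h t \<le> 4 * (real T + 1) / (real t + 1) * C"
  using t
proof (induction t rule: dec_induct)
  case base
  have eq: "4 * (real T + 1) / (real T + 1) = 4" by (rule nonzero_mult_div_cancel_right) simp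
  show ?case unfolding eq using hT C by simp
next
  case (step t)
  define E where "E = 4 * (real T + 1) * C"
  define s where "s = real t"
  have s: "s \<ge> 0" by (simp add: s_def)
  have E: "4 * C \<le> E" "E \<ge> 0" using C by (auto simp: E_def algebra_simps)
  have "h (Suc t) \<le> (1 - 2 / (s + 2)) * h t + (2 / (s + 2))\<^sup>2 * C"
    using assms(3)[OF step(1)] by (simp add: s_def)
  also have "(1 - 2 / (s + 2)) * h t \<le> (1 - 2 / (s + 2)) * (E / (s + 1))"
    using step.IH s by (intro mult_left_mono) (auto simp: E_def s_def field_simps)
  also have "(2 / (s + 2))\<^sup>2 * C \<le> E / (s + 2)\<^sup>2"
    using E s by (simp add: power_divide divide_right_mono)
  also have "(1 - 2 / (s + 2)) * (E / (s + 1)) + E / (s + 2)\<^sup>2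
      = E / (s + 2) * (s / (s + 1) + 1 / (s + 2))"
    using s by (simp add: divide_simps) (simp add: algebra_simps power2_eq_square)
  also have "s / (s + 1) + 1 / (s + 2) \<le> s / (s + 1) + 1 / (s + 1)"
    using s by (intro add_left_mono divide_left_mono) auto
  also have "s / (s + 1) + 1 / (s + 1) = 1"
    using s by (simp flip: add_divide_distrib)
  finally show ?case using E s by (simp add: E_def s_def add.commute mult_left_mono divide_right_mono)
qed

theorem theorem2p4:
  fixes f :: "real^'n \<Rightarrow> ereal"
    and X :: "(real^'n) set"
    and M \<nu> :: real
    and x0 xstar :: "real^'n"
    and x v :: "nat \<Rightarrow> real^'n"
  assumes "compact X" and "convex X"
    and "gen_self_concordant M \<nu> f" and "\<nu> \<ge> 2"
    and "x0 \<in> X \<inter> edom f"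
    and "is_arg_min f (\<lambda>y. y \<in> X) xstar"
    and "monotonic_FW f X x0 x v"
  shows "let D = diameter X;
             L = Lf f (initial_level_set f X x0);
             T = T_idx M \<nu> D L;
             h = primal_gap f xstar
         in \<forall>t. (t \<ge> T \<longrightarrow>
                   h (x t) \<le> 4 * (real T + 1) / (real t + 1)
                              * max (h x0) (L * D\<^sup>2 * omega \<nu> (1/2)))
              \<and> (t < T \<longrightarrow> h (x t) \<le> h x0)"
proof -
  define L0 where "L0 = initial_level_set f X x0"
  define D where "D = diameter X"
  define L where "L = Lf f L0"
  define T where "T = T_idx M \<nu> D L"
  define h where "h = primal_gap f xstar"
  define C where "C = max (h x0) (L * D\<^sup>2 * omega \<nu> (1/2))"
  define y where "y = (\<lambda>t. x t + (2 / (real t + 2)) *\<^sub>R (v t - x t))"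
  have closed: "closed_convex_fun f" using assms(3) by (simp add: gen_self_concordant_def)
  note fin = edom_ereal_fin[OF closed]
  have xstar: "xstar \<in> X" "f xstar \<le> f x0"
    using assms(5,6) by (auto simp: is_arg_min_linorder)
  then have xstar_dom: "xstar \<in> edom f"
    using assms(5) by (auto simp: edom_def)
  have FW: "x 0 = x0" "is_arg_min (\<lambda>y. grad (fin f) (x t) \<bullet> y) (\<lambda>y. y \<in> X) (v t)"
    "x (Suc t) = (if y t \<notin> edom f \<or> f (y t) > f (x t) then x t else y t)" for t
    using assms(7) by (auto simp: monotonic_FW_def y_def Let_def)
  \<comment> \<open>The acceptance test prevents increase and convexity of \<open>X\<close>
    preserves feasibility. This gives the bound before \<open>T\<close> and makes one curvature
    constant valid at every iterate.\<close>
  have inv: "x t \<in> L0" for t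
  proof (induction t)
    case 0
    then show ?case using FW(1) assms(5) by (simp add: L0_def initial_level_set_def)
  next
    case (Suc t)
    have "x t \<in> X" "v t \<in> X"
      using Suc FW(2)[of t] by (auto simp: L0_def initial_level_set_def is_arg_min_linorder)
    moreover have "y t = (1 - 2 / (real t + 2)) *\<^sub>R x t + (2 / (real t + 2)) *\<^sub>R v t"
      by (simp add: y_def algebra_simps)
    ultimately have "y t \<in> X" using assms(2) by (simp add: convexD)
    then show ?case using Suc FW(3)[of t] by (auto simp: L0_def initial_level_set_def)
  qed
  have h_le: "h a \<le> h b" if "a \<in> edom f" "b \<in> edom f" "f a \<le> f b" for a b
    using that fin[of a] fin[of b] by (simp add: h_def primal_gap_def)
  have h_init: "h (x t) \<le> h x0" for t
    using inv[of t] assms(5) by (intro h_le) (auto simp: L0_def initial_level_set_def)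
  have "h x0 \<ge> 0"
    using h_le[OF xstar_dom _ xstar(2)] assms(5) by (simp add: h_def primal_gap_def)
  then have C: "C \<ge> 0" by (simp add: C_def)
  have step: "h (x (Suc t)) \<le> (1 - 2 / (real t + 2)) * h (x t) + (2 / (real t + 2))\<^sup>2 * C" if t: "T \<le> t" for t
  proof -
    note * = FW_step[OF assms(3,4,1,5) inv[of t, unfolded L0_def] xstar(1) xstar_dom FW(2)
        t[unfolded T_def L_def L0_def D_def]]
    have dom: "y t \<in> edom f" using *(1) by (simp add: y_def)
    have xt: "x t \<in> edom f" using inv[of t] by (simp add: L0_def initial_level_set_def)
    \<comment> \<open>The candidate lies in the domain, so it can be rejected only for exceeding
      \<open>f (x t)\<close>; the retained iterate is then the better one.\<close>
    have "h (x (Suc t)) \<le> h (y t)"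
      using FW(3)[of t] dom xt by (auto intro!: h_le)
    also have "\<dots> \<le> (1 - 2 / (real t + 2)) * h (x t) + (2 / (real t + 2))\<^sup>2 * (L * D\<^sup>2 * omega \<nu> (1/2))"
      using *(2) by (simp add: y_def h_def L_def D_def L0_def)
    also have "\<dots> \<le> (1 - 2 / (real t + 2)) * h (x t) + (2 / (real t + 2))\<^sup>2 * C"
      by (intro add_left_mono mult_left_mono) (simp_all add: C_def)
    finally show ?thesis .
  qed
  \<comment> \<open>Including \<open>h x0\<close> in the maximum lets the recursion start at
    \<open>T\<close>, where monotonicity is the only information about the gap.\<close>
  have "h (x T) \<le> C" using h_init[of T] by (simp add: C_def)
  then have "h (x t) \<le> 4 * (real T + 1) / (real t + 1) * C" if "T \<le> t" for t
    using FW_recursion_rate[of C "\<lambda>t. h (x t)" T t] C step that by blast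
  then show ?thesis
    using h_init unfolding Let_def C_def h_def T_def D_def L_def L0_def by blast
qed

end
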